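(* Let $a,b,c\geq 1$ be integers and let $x$ be a nonzero complex number with $x^3\neq 1$. Let $n\geq 0$, $m\geq 0$ be integers such that $n\geq m$. Then $$\mathcal{BJ}_{n+1}^{(a,b,c)}(x)\,\mathcal{BJ}_{m}^{(a,b,c)}(x)-\mathcal{BJ}_{n}^{(a,b,c)}(x)\,\mathcal{BJ}_{m+1}^{(a,b,c)}(x)=\frac{1}{(x^{2}+x+1)^{2}}\Big((x^{2}+x+1)\mathcal{A}_{m-n}\Phi_{1}\Phi_{2}+ x^{n+1}\Theta \left(\mathcal{B}_{m}(1)-x^{m-n}\mathcal{B}_{n}(1)\right)\Big).$$
   Context: The third-order Jacobsthal polynomials are defined, for $x^3\neq 1$, by $\mathcal{J}_{0}^{(3)}(x)=0$, $\mathcal{J}_{1}^{(3)}(x)=1$, $\mathcal{J}_{2}^{(3)}(x)=x-1$ and $\mathcal{J}_{n+3}^{(3)}(x)=(x-1)\mathcal{J}_{n+2}^{(3)}(x)+(x-1)\mathcal{J}_{n+1}^{(3)}(x)+x\mathcal{J}_{n}^{(3)}(x)$ for $n\geq 0$. Bihyperbolic numbers are the elements $a_0+a_1j_1+a_2j_2+a_3j_3$ with multiplication determined by $j_1^2=j_2^2=j_3^2=1$, $j_1j_2=j_2j_1=j_3$, $j_1j_3=j_3j_1=j_2$, $j_2j_3=j_3j_2=j_1$; this gives a commutative associative unital algebra with basis $1,j_1,j_2,j_3$ (over $\mathbb{R}$ for bihyperbolic numbers proper). All identities are read in its complexification, i.e. coefficients $a_i$ are allowed to be complex. For integers $a,b,c\geq1$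 and $n\geq 0$, the generalized bihyperbolic third-order Jacobsthal polynomial is $\mathcal{BJ}_{n}^{(a,b,c)}(x)=\mathcal{J}_{n}^{(3)}(x)+\mathcal{J}_{n+a}^{(3)}(x)j_{1}+\mathcal{J}_{n+b}^{(3)}(x)j_{2}+\mathcal{J}_{n+c}^{(3)}(x)j_{3}$. Let $\omega_1,\omega_2$ be the two (complex) roots of $\lambda^2+\lambda+1=0$. Put $\Theta=1+x^{a}j_{1}+x^{b}j_{2}+x^{c}j_{3}$, $\Phi_{1}=1+\omega_{1}^{a}j_{1}+\omega_{1}^{b}j_{2}+\omega_{1}^{c}j_{3}$, $\Phi_{2}=1+\omega_{2}^{a}j_{1}+\omega_{2}^{b}j_{2}+\omega_{2}^{c}j_{3}$, $\mathcal{Z}_{n}(x)=\frac{1}{\omega_{1}-\omega_{2}}\left((\omega_{1}x-1)\omega_{1}^{n}\Phi_{1}-(\omega_{2}x-1)\omega_{2}^{n}\Phi_{2}\right)$, $\mathcal{A}_{k}=\frac{\omega_{1}^{k}-\omega_{2}^{k}}{\omega_{1}-\omega_{2}}$ for every integer $k$ (possibly negative), and $\mathcal{B}_{n}(p)=\mathcal{Z}_{n+p}(x)-x^{p}\mathcal{Z}_{n}(x)$. *)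

theory Defs
  imports Complex_Main
begin

section \<open>Bihyperbolic numbers\<close>

text \<open>
  \<^term>\<open>Bihyp a0 a1 a2 a3\<close> stands for $a_0 + a_1 j_1 + a_2 j_2 + a_3 j_3$. The coefficients range over a
  type parameter: \<^typ>\<open>real\<close> gives the bihyperbolic numbers proper, \<^typ>\<open>complex\<close> their complexification.
\<close>

datatype 'a bihyp = Bihyp (bh0: 'a) (bh1: 'a) (bh2: 'a) (bh3: 'a)

instantiation bihyp :: (comm_ring_1) comm_ring_1
begin

definition zero_bihyp :: "'a bihyp" where
  "0 = Bihyp 0 0 0 0"

definition one_bihyp :: "'a bihyp" where
  "1 = Bihyp 1 0 0 0"

definition plus_bihyp :: "'a bihyp \<Rightarrow> 'a bihyp \<Rightarrow> 'a bihyp" where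
  "u + v = Bihyp (bh0 u + bh0 v) (bh1 u + bh1 v) (bh2 u + bh2 v) (bh3 u + bh3 v)"

definition uminus_bihyp :: "'a bihyp \<Rightarrow> 'a bihyp" where
  "- u = Bihyp (- bh0 u) (- bh1 u) (- bh2 u) (- bh3 u)"

definition minus_bihyp :: "'a bihyp \<Rightarrow> 'a bihyp \<Rightarrow> 'a bihyp" where
  "u - v = Bihyp (bh0 u - bh0 v) (bh1 u - bh1 v) (bh2 u - bh2 v) (bh3 u - bh3 v)"

text \<open>
  The bilinear extension of the multiplication table of $1, j_1, j_2, j_3$;
  the table itself is recovered in \<open>bh_unit_table\<close> below.
\<close>

definition times_bihyp :: "'a bihyp \<Rightarrow> 'a bihyp \<Rightarrow> 'a bihyp" where
  "u * v = Bihyp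
     (bh0 u * bh0 v + bh1 u * bh1 v + bh2 u * bh2 v + bh3 u * bh3 v)
     (bh0 u * bh1 v + bh1 u * bh0 v + bh2 u * bh3 v + bh3 u * bh2 v)
     (bh0 u * bh2 v + bh2 u * bh0 v + bh1 u * bh3 v + bh3 u * bh1 v)
     (bh0 u * bh3 v + bh3 u * bh0 v + bh1 u * bh2 v + bh2 u * bh1 v)"

instance
  by standard
    (simp_all add: zero_bihyp_def one_bihyp_def plus_bihyp_def uminus_bihyp_def
      minus_bihyp_def times_bihyp_def algebra_simps)

end

definition bh_scale :: "'a::comm_ring_1 \<Rightarrow> 'a bihyp \<Rightarrow> 'a bihyp" (infixr "*\<^sub>B" 75) where
  "k *\<^sub>B u = Bihyp (k * bh0 u) (k * bh1 u) (k * bh2 u) (k * bh3 u)"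

definition j1 :: "'a::comm_ring_1 bihyp" where "j1 = Bihyp 0 1 0 0"
definition j2 :: "'a::comm_ring_1 bihyp" where "j2 = Bihyp 0 0 1 0"
definition j3 :: "'a::comm_ring_1 bihyp" where "j3 = Bihyp 0 0 0 1"

lemma bh_unit_table:
  "j1 * j1 = 1" "j2 * j2 = 1" "j3 * j3 = 1"
  "j1 * j2 = j3" "j2 * j1 = j3"
  "j1 * j3 = j2" "j3 * j1 = j2"
  "j2 * j3 = j1" "j3 * j2 = j1"
  by (simp_all add: j1_def j2_def j3_def times_bihyp_def one_bihyp_def)

lemma Bihyp_eq:
  "Bihyp a0 a1 a2 a3 = a0 *\<^sub>B 1 + a1 *\<^sub>B j1 + a2 *\<^sub>B j2 + a3 *\<^sub>B j3"
  by (simp add: j1_def j2_def j3_def one_bihyp_def plus_bihyp_def bh_scale_def)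

lemma bh_scale_module: "module bh_scale"
  by standard (simp_all add: bh_scale_def plus_bihyp_def algebra_simps)

lemma bh_scale_mult:
  "(k *\<^sub>B u) * v = k *\<^sub>B (u * v)" "u * (k *\<^sub>B v) = k *\<^sub>B (u * v)"
  by (simp_all add: bh_scale_def times_bihyp_def algebra_simps)


section \<open>Third-order Jacobsthal polynomials\<close>

fun jacobsthal3 :: "nat \<Rightarrow> complex \<Rightarrow> complex" where
  "jacobsthal3 0 x = 0"
| "jacobsthal3 (Suc 0) x = 1"
| "jacobsthal3 (Suc (Suc 0)) x = x - 1"
| "jacobsthal3 (Suc (Suc (Suc n))) x =
     (x - 1) * jacobsthal3 (Suc (Suc n)) x + (x - 1) * jacobsthal3 (Suc n) x + x * jacobsthal3 n x"

definition bh_jacobsthal3 :: "nat \<Rightarrow> nat \<Rightarrow> nat \<Rightarrow> nat \<Rightarrow> complex \<Rightarrow> complex bihyp" where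
  "bh_jacobsthal3 a b c n x =
     jacobsthal3 n x *\<^sub>B 1 + jacobsthal3 (n + a) x *\<^sub>B j1
     + jacobsthal3 (n + b) x *\<^sub>B j2 + jacobsthal3 (n + c) x *\<^sub>B j3"


section \<open>Auxiliary quantities\<close>

definition Theta :: "nat \<Rightarrow> nat \<Rightarrow> nat \<Rightarrow> complex \<Rightarrow> complex bihyp" where
  "Theta a b c x = 1 + x ^ a *\<^sub>B j1 + x ^ b *\<^sub>B j2 + x ^ c *\<^sub>B j3"

definition Phi :: "nat \<Rightarrow> nat \<Rightarrow> nat \<Rightarrow> complex \<Rightarrow> complex bihyp" where
  "Phi a b c w = 1 + w ^ a *\<^sub>B j1 + w ^ b *\<^sub>B j2 + w ^ c *\<^sub>B j3"

text \<open>
  In the following definitions \<open>w1\<close> and \<open>w2\<close> are meant to be the two roots of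
  $\lambda^2 + \lambda + 1$.
\<close>

definition Zseq ::
  "nat \<Rightarrow> nat \<Rightarrow> nat \<Rightarrow> complex \<Rightarrow> complex \<Rightarrow> nat \<Rightarrow> complex \<Rightarrow> complex bihyp" where
  "Zseq a b c w1 w2 n x =
     (1 / (w1 - w2)) *\<^sub>B
       (((w1 * x - 1) * w1 ^ n) *\<^sub>B Phi a b c w1 - ((w2 * x - 1) * w2 ^ n) *\<^sub>B Phi a b c w2)"

definition Aseq :: "complex \<Rightarrow> complex \<Rightarrow> int \<Rightarrow> complex" where
  "Aseq w1 w2 k = (w1 powi k - w2 powi k) / (w1 - w2)"

definition Bseq3 ::
  "nat \<Rightarrow> nat \<Rightarrow> nat \<Rightarrow> complex \<Rightarrow> complex \<Rightarrow> nat \<Rightarrow> nat \<Rightarrow> complex \<Rightarrow> complex bihyp" where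
  "Bseq3 a b c w1 w2 n p x = Zseq a b c w1 w2 (n + p) x - x ^ p *\<^sub>B Zseq a b c w1 w2 n x"

end

theory Submission
  imports Defs
begin

text \<open>
  Write $s = x^2 + x + 1$. The characteristic polynomial of the recurrence factors as
  $(\lambda - x)(\lambda^2 + \lambda + 1)$, so the sequence splits into a geometric part in $x$ and
  a part that is periodic because \<open>\<omega>1\<close> and \<open>\<omega>2\<close> are cube roots of unity. Fitting the initial
  values gives, coordinate by coordinate, the Binet formula
  $s\,BJ_n = x^{n+1}\Theta - Z_n$ (\<open>bh_jacobsthal3_binet\<close>).

  The left-hand side of the theorem is a $2 \times 2$ determinant in $BJ$. Expanding it with the
  Binet formula, the $\Theta^2$ terms cancel, because a geometric sequence has vanishing
  determinant. The terms linear in $\Theta$ collect to the $B$-part of the claim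
  (\<open>geometric_perturbation_determinant\<close>). What remains is the same determinant for $Z$: there the
  pure $\omega_1$ and pure $\omega_2$ terms cancel in the same way, and the mixed ones give
  $(\omega_1 x - 1)(\omega_2 x - 1)\,\Phi_1\Phi_2 = s\,\Phi_1\Phi_2$ times a difference of powers
  (\<open>Zseq_determinant\<close>). Both sides have now been multiplied by $s^2$, which can be cancelled
  because $(x - 1)\,s = x^3 - 1 \neq 0$.
\<close>

interpretation bh: module "bh_scale :: 'a::comm_ring_1 \<Rightarrow> 'a bihyp \<Rightarrow> 'a bihyp"
  by (rule bh_scale_module)

lemmas bh_algebra = bh_scale_mult bh.scale_left_distrib bh.scale_right_distrib
  bh.scale_left_diff_distrib bh.scale_right_diff_distrib

text \<open>Two distinct roots of $\lambda^2 + \lambda + 1$ exhaust its roots, so Vieta applies.\<close>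

lemma primitive_cube_roots_vieta:
  fixes w1 w2 :: "'a::idom"
  assumes "w1\<^sup>2 + w1 + 1 = 0" and "w2\<^sup>2 + w2 + 1 = 0" and "w1 \<noteq> w2"
  shows "w1 + w2 = -1" and "w1 * w2 = 1"
proof -
  have "(w1 - w2) * (w1 + w2 + 1) = (w1\<^sup>2 + w1 + 1) - (w2\<^sup>2 + w2 + 1)"
    by (simp add: algebra_simps power2_eq_square)
  hence "w1 + w2 + 1 = 0"
    using assms by simp
  thus sum: "w1 + w2 = -1"
    by (simp add: eq_neg_iff_add_eq_0)
  have "w1 * w2 - 1 = w1 * (w1 + w2 + 1) - (w1\<^sup>2 + w1 + 1)"
    by (simp add: algebra_simps power2_eq_square)
  thus "w1 * w2 = 1"
    using assms(1) \<open>w1 + w2 + 1 = 0\<close> by simp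
qed

text \<open>
  Both sides solve the same third-order recurrence, as $x$, \<open>w1\<close> and \<open>w2\<close> are the roots of its
  characteristic polynomial; so the first three values decide.
\<close>

lemma jacobsthal3_binet:
  assumes w1: "w1\<^sup>2 + w1 + 1 = 0" and w2: "w2\<^sup>2 + w2 + 1 = 0" and ne: "w1 \<noteq> w2"
  shows "(x\<^sup>2 + x + 1) * jacobsthal3 n x =
    x ^ (n + 1) - ((w1 * x - 1) * w1 ^ n - (w2 * x - 1) * w2 ^ n) / (w1 - w2)"
proof -
  note vieta = primitive_cube_roots_vieta[OF assms]
  have d: "w1 - w2 \<noteq> 0" using ne by simp
  define V where "V k = ((w1 * x - 1) * w1 ^ k - (w2 * x - 1) * w2 ^ k) / (w1 - w2)" for k
  have V0: "V 0 = x"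
    using d by (simp add: V_def field_simps)
  have "(w1 * x - 1) * w1 - (w2 * x - 1) * w2 = ((w1 + w2) * x - 1) * (w1 - w2)"
    by (simp add: algebra_simps)
  hence V1: "V 1 = - x - 1"
    using d vieta by (simp add: V_def)
  have sq: "w * w ^ Suc k = - (w * w ^ k) - w ^ k" if "w\<^sup>2 + w + 1 = 0" for w :: complex and k
  proof -
    have "w * w = - w - 1"
      using that by (simp add: power2_eq_square algebra_simps eq_neg_iff_add_eq_0)
    hence "w * w * w ^ k = (- w - 1) * w ^ k"
      by simp
    thus ?thesis
      by (simp add: algebra_simps)
  qed
  have V_rec: "V (Suc (Suc k)) = - V (Suc k) - V k" for k
  proof -
    have "(w1 * x - 1) * w1 ^ Suc (Suc k) - (w2 * x - 1) * w2 ^ Suc (Suc k) =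
        (w1 * x - 1) * (- (w1 * w1 ^ k) - w1 ^ k) - (w2 * x - 1) * (- (w2 * w2 ^ k) - w2 ^ k)"
      by (simp only: power_Suc[of _ "Suc _"] sq[OF w1] sq[OF w2])
    also have "\<dots> = - ((w1 * x - 1) * w1 ^ Suc k - (w2 * x - 1) * w2 ^ Suc k)
        - ((w1 * x - 1) * w1 ^ k - (w2 * x - 1) * w2 ^ k)"
      by (simp add: algebra_simps)
    finally show ?thesis
      unfolding V_def by (simp only: diff_divide_distrib minus_divide_left[symmetric])
  qed
  have "(x\<^sup>2 + x + 1) * jacobsthal3 n x = x ^ (n + 1) - V n"
  proof (induction n rule: less_induct)
    case (less n)
    consider "n = 0" | "n = 1" | "n = 2" | k where "n = Suc (Suc (Suc k))"
      by (metis One_nat_def numeral_2_eq_2 not0_implies_Suc)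
    thus ?case
    proof cases
      case 1
      thus ?thesis by (simp add: V0)
    next
      case 2
      thus ?thesis using V1 by (simp add: power2_eq_square)
    next
      case 3
      have "V (Suc (Suc 0)) = 1"
        using V_rec[of 0] V0 V1 by simp
      thus ?thesis
        using 3 by (simp add: numeral_2_eq_2 algebra_simps)
    next
      case (4 k)
      have "(x\<^sup>2 + x + 1) * jacobsthal3 n x =
          (x - 1) * ((x\<^sup>2 + x + 1) * jacobsthal3 (Suc (Suc k)) x)
          + (x - 1) * ((x\<^sup>2 + x + 1) * jacobsthal3 (Suc k) x)
          + x * ((x\<^sup>2 + x + 1) * jacobsthal3 k x)"
        unfolding 4 by (simp add: algebra_simps)
      also have "\<dots> = (x - 1) * (x ^ (k + 3) - V (Suc (Suc k)))
          + (x - 1) * (x ^ (k + 2) - V (Suc k)) + x * (x ^ (k + 1) - V k)"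
        using less.IH[of k] less.IH[of "Suc k"] less.IH[of "Suc (Suc k)"] 4
        by (simp add: numeral_3_eq_3)
      also have "\<dots> = x ^ (n + 1) - V n"
        unfolding 4 V_rec by (simp add: algebra_simps numeral_3_eq_3)
      finally show ?thesis .
    qed
  qed
  thus ?thesis by (simp add: V_def)
qed

lemma bh_jacobsthal3_binet:
  assumes "w1\<^sup>2 + w1 + 1 = 0" and "w2\<^sup>2 + w2 + 1 = 0" and "w1 \<noteq> w2"
  shows "(x\<^sup>2 + x + 1) *\<^sub>B bh_jacobsthal3 a b c n x =
    x ^ (n + 1) *\<^sub>B Theta a b c x - Zseq a b c w1 w2 n x"
proof -
  have coord: "(x\<^sup>2 + x + 1) * jacobsthal3 (n + k) x = x ^ (n + 1) * x ^ k
      - 1 / (w1 - w2) * ((w1 * x - 1) * w1 ^ n * w1 ^ k - (w2 * x - 1) * w2 ^ n * w2 ^ k)" for k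
    using jacobsthal3_binet[OF assms, of x "n + k"] by (simp add: power_add mult_ac)
  show ?thesis
    using coord[of 0] coord[of a] coord[of b] coord[of c]
    by (simp add: bh_jacobsthal3_def Theta_def Zseq_def Phi_def bh_scale_def plus_bihyp_def
        minus_bihyp_def one_bihyp_def j1_def j2_def j3_def)
qed

text \<open>
  A geometric sequence $x^{k}\,T$ has vanishing $2 \times 2$ determinants, so a perturbation of it by
  $Z$ contributes only terms linear in $T$ and the determinant of $Z$ itself.
\<close>

lemma geometric_perturbation_determinant:
  fixes T :: "'a::comm_ring_1 bihyp"
  shows "((x * p) *\<^sub>B T - Z') * (q *\<^sub>B T - W) - (p *\<^sub>B T - Z) * ((x * q) *\<^sub>B T - W') =
    T * (p *\<^sub>B (W' - x *\<^sub>B W) - q *\<^sub>B (Z' - x *\<^sub>B Z)) + (Z' * W - Z * W')"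
  by (simp add: bh_algebra algebra_simps)

text \<open>
  For $Z_k = u\,\omega_1^k - v\,\omega_2^k$ only the mixed terms survive, and
  $\omega_1\omega_2 = 1$ turns $\omega_1^m\omega_2^n$ and $\omega_1^n\omega_2^m$ into the integer
  powers $\omega_1^{m-n}$ and $\omega_2^{m-n}$ that make up the sequence $A$.
\<close>

lemma Zseq_determinant:
  assumes "w1\<^sup>2 + w1 + 1 = 0" and "w2\<^sup>2 + w2 + 1 = 0" and "w1 \<noteq> w2"
  shows "Zseq a b c w1 w2 (n + 1) x * Zseq a b c w1 w2 m x
       - Zseq a b c w1 w2 n x * Zseq a b c w1 w2 (m + 1) x
     = ((x\<^sup>2 + x + 1) * Aseq w1 w2 (int m - int n)) *\<^sub>B (Phi a b c w1 * Phi a b c w2)"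
proof -
  note vieta = primitive_cube_roots_vieta[OF assms]
  have d: "w1 - w2 \<noteq> 0" using assms(3) by simp
  have nz: "w1 \<noteq> 0" "w2 \<noteq> 0" using vieta(2) by auto
  have inv: "w2 = inverse w1" "w1 = inverse w2"
    using vieta(2) nz by (simp_all add: field_simps)
  have A: "Aseq w1 w2 (int m - int n) = (w1 ^ m * w2 ^ n - w1 ^ n * w2 ^ m) / (w1 - w2)"
  proof -
    have "w1 powi (int m - int n) = w1 ^ m * w2 ^ n"
      using nz(1) by (simp add: power_int_diff inv(1) power_inverse field_simps)
    moreover have "w2 powi (int m - int n) = w1 ^ n * w2 ^ m"
      using nz(2) by (simp add: power_int_diff inv(2) power_inverse field_simps)
    ultimately show ?thesis by (simp add: Aseq_def)
  qed
  have s: "(w1 * x - 1) * (w2 * x - 1) = x\<^sup>2 + x + 1"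
  proof -
    have "(w1 * x - 1) * (w2 * x - 1) = (w1 * w2) * x\<^sup>2 - (w1 + w2) * x + 1"
      by (simp add: algebra_simps power2_eq_square)
    thus ?thesis by (simp add: vieta)
  qed
  define f g where "f k = (w1 * x - 1) * w1 ^ k / (w1 - w2)"
    and "g k = (w2 * x - 1) * w2 ^ k / (w1 - w2)" for k
  have Z: "Zseq a b c w1 w2 k x = f k *\<^sub>B Phi a b c w1 - g k *\<^sub>B Phi a b c w2" for k
    by (simp add: Zseq_def f_def g_def bh_algebra)
  have f1: "f (k + 1) = w1 * f k" and g1: "g (k + 1) = w2 * g k" for k
    by (simp_all add: f_def g_def)
  have two_term: "((w1 * p) *\<^sub>B P - (w2 * q) *\<^sub>B Q) * (r *\<^sub>B P - t *\<^sub>B Q)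
      - (p *\<^sub>B P - q *\<^sub>B Q) * ((w1 * r) *\<^sub>B P - (w2 * t) *\<^sub>B Q)
      = ((w1 - w2) * (q * r - p * t)) *\<^sub>B (P * Q)" for p q r t and P Q :: "complex bihyp"
    by (simp add: bh_algebra algebra_simps)
  have "(w1 - w2) * (g n * f m - f n * g m) =
      (w1 * x - 1) * (w2 * x - 1) * ((w1 ^ m * w2 ^ n - w1 ^ n * w2 ^ m) / (w1 - w2))"
    using d by (simp add: f_def g_def divide_simps) (simp add: algebra_simps)
  thus ?thesis
    by (simp only: Z f1 g1 two_term s A)
qed

theorem corollary2p9:
  fixes a b c n m :: nat and x \<omega>1 \<omega>2 :: complex
  assumes "a \<ge> 1" and "b \<ge> 1" and "c \<ge> 1"
    and "x \<noteq> 0" and "x ^ 3 \<noteq> 1"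
    and "n \<ge> m"
    and "\<omega>1\<^sup>2 + \<omega>1 + 1 = 0" and "\<omega>2\<^sup>2 + \<omega>2 + 1 = 0" and "\<omega>1 \<noteq> \<omega>2"
  shows "bh_jacobsthal3 a b c (n + 1) x * bh_jacobsthal3 a b c m x
       - bh_jacobsthal3 a b c n x * bh_jacobsthal3 a b c (m + 1) x
     = (1 / (x\<^sup>2 + x + 1)\<^sup>2) *\<^sub>B
         (((x\<^sup>2 + x + 1) * Aseq \<omega>1 \<omega>2 (int m - int n)) *\<^sub>B (Phi a b c \<omega>1 * Phi a b c \<omega>2)
          + x ^ (n + 1) *\<^sub>B (Theta a b c x *
              (Bseq3 a b c \<omega>1 \<omega>2 m 1 x - x powi (int m - int n) *\<^sub>B Bseq3 a b c \<omega>1 \<omega>2 n 1 x)))"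
    (is "?L = (1 / ?s\<^sup>2) *\<^sub>B (?A + x ^ (n + 1) *\<^sub>B (?T * (?Bm - _ *\<^sub>B ?Bn)))")
proof -
  note roots = \<open>\<omega>1\<^sup>2 + \<omega>1 + 1 = 0\<close> \<open>\<omega>2\<^sup>2 + \<omega>2 + 1 = 0\<close> \<open>\<omega>1 \<noteq> \<omega>2\<close>
  let ?J = "\<lambda>k. bh_jacobsthal3 a b c k x" and ?Z = "\<lambda>k. Zseq a b c \<omega>1 \<omega>2 k x"
  have "(x - 1) * ?s = x ^ 3 - 1"
    by (simp add: algebra_simps power2_eq_square power3_eq_cube)
  hence s: "?s \<noteq> 0"
    using \<open>x ^ 3 \<noteq> 1\<close> by auto
  have shift: "x ^ (n + 1) * x powi (int m - int n) = x ^ (m + 1)"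
    using \<open>x \<noteq> 0\<close> by (simp add: power_int_diff)
  have "?s\<^sup>2 *\<^sub>B ?L =
      (?s *\<^sub>B ?J (n + 1)) * (?s *\<^sub>B ?J m) - (?s *\<^sub>B ?J n) * (?s *\<^sub>B ?J (m + 1))"
    by (simp only: bh_scale_mult bh.scale_right_diff_distrib bh.scale_scale power2_eq_square)
  also have "\<dots> =
      ((x * x ^ (n + 1)) *\<^sub>B ?T - ?Z (n + 1)) * (x ^ (m + 1) *\<^sub>B ?T - ?Z m)
      - (x ^ (n + 1) *\<^sub>B ?T - ?Z n) * ((x * x ^ (m + 1)) *\<^sub>B ?T - ?Z (m + 1))"
    by (simp add: bh_jacobsthal3_binet[OF roots])
  also have "\<dots> = ?T * (x ^ (n + 1) *\<^sub>B ?Bm - x ^ (m + 1) *\<^sub>B ?Bn) + ?A"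
    by (simp only: geometric_perturbation_determinant Zseq_determinant[OF roots] Bseq3_def
        power_one_right)
  also have "\<dots> = ?A + x ^ (n + 1) *\<^sub>B (?T * (?Bm - x powi (int m - int n) *\<^sub>B ?Bn))"
    by (simp only: bh_scale_mult bh.scale_right_diff_distrib bh.scale_scale right_diff_distrib
        shift[symmetric] add.commute[of _ ?A])
  finally have "(1 / ?s\<^sup>2) *\<^sub>B (?s\<^sup>2 *\<^sub>B ?L) =
      (1 / ?s\<^sup>2) *\<^sub>B (?A + x ^ (n + 1) *\<^sub>B (?T * (?Bm - x powi (int m - int n) *\<^sub>B ?Bn)))"
    by (rule arg_cong)
  thus ?thesis
    using s by simp
qed

end
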